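(* Let $n\ge 1$ and $0\le k\le n$ be integers, let $A$ be an integer matrix with $n$ columns, let $b$ be a real vector (with as many entries as $A$ has rows), let $h\in\mathbb R^n$, and let $q_1,\dots,q_k>0$ be real numbers. Let $P=\{x\in\mathbb R^n : Ax\le b\}$, let $f(x)=\sum_{i=1}^k -q_i x_i^2+h^{\mathsf T}x$, and let $\Delta$ be the largest absolute value of the subdeterminants of $A$. Consider the problems $$\text{(IQP)}\quad \min\{f(x) : x\in P\cap\mathbb Z^n\},\qquad \text{(QP)}\quad \min\{f(x) : x\in P\}.$$ Suppose that both problems have an optimal solution. Then: (i) Let $x^c$ be an optimal solution to (QP). Then, for every $\epsilon\in(0,1]$, there is an $\epsilon$-approximate solution $x^*$ to (IQP) such that $$\|x^c-x^*\|_\infty\le n\Delta\left(\frac{10\Delta}{\epsilon}+1\right)^k.$$ (ii) Let $x^d$ be an optimal solution to (IQP). Then, for every $\epsilon\in(0,1]$, there is an $\epsilon$-approximate solution $x^\star$ to (QP) such that $$\|x^\star-x^d\|_\infty\le n\Delta\left(\frac{10\Delta}{\epsilon}+1\right)^k.$$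
   Context: A subdeterminant of a matrix $A$ is the determinant of a square submatrix of $A$; by convention the empty ($0\times 0$) submatrix has determinant $1$, so that $\Delta\ge 1$ always (for a nonzero integer matrix this is automatic). $\epsilon$-approximate solution: consider a problem $\min\{f(x): x\in S\}$ with $S\subseteq\mathbb R^n$ that has an optimal solution $x^{\mathrm{opt}}$, and let $f_{\max}$ be the maximum (supremum) value of $f$ on $S$. For $\epsilon\in[0,1]$, a feasible point $x^*\in S$ is an $\epsilon$-approximate solution if $f(x^* )-f(x^{\mathrm{opt}})\le\epsilon\,(f_{\max}-f(x^{\mathrm{opt}}))$. If $f$ is unbounded above on $S$, then every feasible point is an $\epsilon$-approximate solution for every $\epsilon>0$. For (IQP) the feasible set is $S=P\cap\mathbb Z^n$, and for (QP) it is $S=P$, so $x^{\mathrm{opt}}$ and $f_{\max}$ are taken with respect to the corresponding set. *)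

theory Defs
  imports Complex_Main "Jordan_Normal_Form.Determinant" "Jordan_Normal_Form.DL_Submatrix"
begin

text \<open>The largest absolute value of a subdeterminant. The choice of empty index sets is
  included; it contributes the determinant 1 of the empty matrix.\<close>

definition max_subdet :: "int mat \<Rightarrow> int" where
  "max_subdet A = Max {\<bar>det (submatrix A I J)\<bar> | I J.
     I \<subseteq> {..<dim_row A} \<and> J \<subseteq> {..<dim_col A} \<and> card I = card J}"

lemma max_subdet_ge_1: "max_subdet A \<ge> 1"
proof -
  let ?S = "{\<bar>det (submatrix A I J)\<bar> | I J.
     I \<subseteq> {..<dim_row A} \<and> J \<subseteq> {..<dim_col A} \<and> card I = card J}"
  have "?S \<subseteq> (\<lambda>(I, J). \<bar>det (submatrix A I J)\<bar>) ` (Pow {..<dim_row A} \<times> Pow {..<dim_col A})"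
    by auto
  then have fin: "finite ?S"
    by (rule finite_subset) auto
  have "\<bar>det (submatrix A {} {})\<bar> = 1"
    by (subst det_dim_zero) (auto simp: submatrix_def)
  then have "1 \<in> ?S"
    by (smt (verit, best) card.empty empty_subsetI mem_Collect_eq)
  with fin show ?thesis
    unfolding max_subdet_def by (rule Max_ge)
qed

definition polyhedron :: "int mat \<Rightarrow> real Matrix.vec \<Rightarrow> real Matrix.vec set" where
  "polyhedron A b = {x \<in> carrier_vec (dim_col A). map_mat real_of_int A *\<^sub>v x \<le> b}"

definition integer_points :: "nat \<Rightarrow> real Matrix.vec set" where
  "integer_points n = {x \<in> carrier_vec n. \<forall>i<n. x $ i \<in> \<int>}"

text \<open>Coordinates are indexed from 0, so the quadratic part involves \<open>x $ 0, \<dots>, x $ (k - 1)\<close>.\<close>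

definition concave_objective ::
    "nat \<Rightarrow> (nat \<Rightarrow> real) \<Rightarrow> real Matrix.vec \<Rightarrow> real Matrix.vec \<Rightarrow> real" where
  "concave_objective k q h x = (\<Sum>i<k. - q i * (x $ i)\<^sup>2) + h \<bullet> x"

definition optimal_solution :: "('a \<Rightarrow> real) \<Rightarrow> 'a set \<Rightarrow> 'a \<Rightarrow> bool" where
  "optimal_solution f S x \<longleftrightarrow> x \<in> S \<and> (\<forall>y\<in>S. f x \<le> f y)"

text \<open>Only meaningful if an optimal solution exists; its choice is immaterial, as all optimal
  solutions have the same value. If \<open>f\<close> is unbounded above on \<open>S\<close>, the supremum is infinite
  and every feasible point qualifies for positive \<open>\<epsilon>\<close>.\<close>

definition approximate_solution :: "('a \<Rightarrow> real) \<Rightarrow> 'a set \<Rightarrow> real \<Rightarrow> 'a \<Rightarrow> bool" where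
  "approximate_solution f S \<epsilon> x \<longleftrightarrow> x \<in> S \<and>
     (\<exists>x_opt. optimal_solution f S x_opt \<and>
        (if bdd_above (f ` S) then f x - f x_opt \<le> \<epsilon> * (Sup (f ` S) - f x_opt) else \<epsilon> > 0))"

text \<open>Inserting 0 only matters for vectors of dimension 0.\<close>

definition linf_norm :: "real Matrix.vec \<Rightarrow> real" where
  "linf_norm x = Max (insert 0 ((\<lambda>i. \<bar>x $ i\<bar>) ` {..<dim_vec x}))"

end

theory Submission
  imports Defs
begin

text \<open>
  Write \<open>x\<^sup>d - x\<^sup>c = \<Sum>j. t\<^sub>j u\<^sub>j\<close> with at most \<open>n\<close> terms, \<open>t\<^sub>j \<ge> 0\<close>, and integral \<open>u\<^sub>j\<close>
  with entries bounded by \<open>\<Delta>\<close> which agree in sign with \<open>x\<^sup>d - x\<^sup>c\<close> in every coordinate and every row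
  of \<open>A\<close>. Then \<open>x\<^sup>c + v\<close> and \<open>x\<^sup>d - v\<close> are feasible for every \<open>v = \<Sum>j. \<mu>\<^sub>j u\<^sub>j\<close> with
  \<open>0 \<le> \<mu>\<^sub>j \<le> t\<^sub>j\<close>. Put \<open>w = x\<^sup>d - x\<^sup>c - v\<close>. As \<open>f\<close> is a separable quadratic,
  \<open>f (x\<^sup>c + v) + f (x\<^sup>d - v) = f x\<^sup>c + f x\<^sup>d + 2 \<Sum>i<k. q\<^sub>i v\<^sub>i w\<^sub>i\<close>, so for integral \<open>\<mu>\<close> optimality of \<open>x\<^sup>c\<close> and
  \<open>x\<^sup>d\<close> bounds the loss of \<open>x\<^sup>d - v\<close> in (IQP) and of \<open>x\<^sup>c + v\<close> in (QP) by \<open>2 \<Sum>i<k. q\<^sub>i v\<^sub>i w\<^sub>i\<close>.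
  Splitting \<open>v = a + b\<close> into two nearly equal integral halves, the same identity shows that
  \<open>f\<^sub>m\<^sub>a\<^sub>x\<close> exceeds the optimum by at least \<open>\<Sum>i<k. q\<^sub>i a\<^sub>i b\<^sub>i\<close>. It remains to choose \<open>\<mu>\<close> such that
  \<open>2 v\<^sub>i w\<^sub>i \<le> \<epsilon> a\<^sub>i b\<^sub>i\<close> for all \<open>i < k\<close>: split the first \<open>k\<close> coordinates into near and far ones with a large
  gap between the two groups, and let \<open>\<mu>\<^sub>j\<close> be 0 if \<open>u\<^sub>j\<close> moves a near coordinate and \<open>\<lfloor>t\<^sub>j\<rfloor>\<close> otherwise.
  Then \<open>v\<close> vanishes on the near coordinates, while on the far ones \<open>w\<close> is tiny compared to \<open>v\<close>.
\<close>

section \<open>Circuits with entries bounded by subdeterminants\<close>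

text \<open>\<open>p i\<close> is the rank of \<open>f i\<close> within the image. As
  \<open>submatrix\<close> lists its rows and columns in increasing order through
  \<open>pick\<close>, this permutation sorts an arbitrary injective selection.\<close>

lemma ex_permutes_pick:
  assumes inj: "inj_on f {0..<s}"
  shows "\<exists>p. p permutes {0..<s} \<and> (\<forall>i<s. pick (f ` {0..<s}) (p i) = f i)"
proof -
  let ?I = "f ` {0..<s}"
  define r where "r = (\<lambda>i. card {a \<in> ?I. a < f i})"
  define p where "p = (\<lambda>i. if i < s then r i else i)"
  have pick: "pick ?I (r i) = f i" if "i < s" for i
    unfolding r_def using that by (intro pick_card_in_set) auto
  have r_less: "r i < s" if "i < s" for i
  proof -
    have "{a \<in> ?I. a < f i} \<subset> ?I" using that by auto
    then have "r i < card ?I" unfolding r_def by (intro psubset_card_mono) auto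
    then show ?thesis by (simp add: card_image inj)
  qed
  have "inj_on p {0..<s}"
  proof (rule inj_onI)
    fix i j assume "i \<in> {0..<s}" "j \<in> {0..<s}" "p i = p j"
    moreover from this have "f i = f j" unfolding p_def using pick by (metis atLeastLessThan_iff)
    ultimately show "i = j" using inj by (auto dest: inj_onD)
  qed
  moreover have "p ` {0..<s} \<subseteq> {0..<s}" unfolding p_def using r_less by auto
  ultimately have "bij_betw p {0..<s} {0..<s}"
    by (simp add: bij_betw_def endo_inj_surj)
  then have "p permutes {0..<s}"
    by (rule bij_imp_permutes) (auto simp: p_def)
  then show ?thesis using pick by (intro exI[of _ p]) (auto simp: p_def)
qed

text \<open>A repeated index makes two rows or columns equal, so the determinant is 0. Otherwise
  sorting both selections yields a genuine submatrix and affects only the sign.\<close>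

lemma abs_det_reindexed_le_max_subdet:
  fixes A :: "int mat"
  assumes f: "\<And>i. i < s \<Longrightarrow> f i < dim_row A" and g: "\<And>j. j < s \<Longrightarrow> g j < dim_col A"
  shows "\<bar>det (mat s s (\<lambda>(i, j). A $$ (f i, g j)))\<bar> \<le> max_subdet A"
proof -
  let ?M = "mat s s (\<lambda>(i, j). A $$ (f i, g j))"
  have M: "?M \<in> carrier_mat s s" by simp
  have zero: "det ?M = 0 \<Longrightarrow> ?thesis" using max_subdet_ge_1[of A] by simp
  show ?thesis
  proof (cases "inj_on f {0..<s} \<and> inj_on g {0..<s}")
    case False
    then consider i j where "i < s" "j < s" "i \<noteq> j" "f i = f j"
      | i j where "i < s" "j < s" "i \<noteq> j" "g i = g j"
      unfolding inj_on_def by auto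
    then show ?thesis
    proof cases
      case 1
      then have "row ?M i = row ?M j" by (intro eq_vecI) auto
      with 1 show ?thesis by (intro zero det_identical_rows[OF M, of i j])
    next
      case 2
      then have "col ?M i = col ?M j" by (intro eq_vecI) auto
      with 2 show ?thesis by (intro zero det_identical_columns[OF M, of i j])
    qed
  next
    case True
    let ?I = "f ` {0..<s}" and ?J = "g ` {0..<s}"
    let ?B = "submatrix A ?I ?J"
    obtain p where p: "p permutes {0..<s}" "\<And>i. i < s \<Longrightarrow> pick ?I (p i) = f i"
      using ex_permutes_pick[of f s] True by auto
    obtain p' where p': "p' permutes {0..<s}" "\<And>i. i < s \<Longrightarrow> pick ?J (p' i) = g i"
      using ex_permutes_pick[of g s] True by auto
    have card: "card ?I = s" "card ?J = s" using True by (auto simp: card_image)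
    have "{i. i < dim_row A \<and> i \<in> ?I} = ?I" "{j. j < dim_col A \<and> j \<in> ?J} = ?J"
      using f g by auto
    then have B: "?B \<in> carrier_mat s s"
      and Bij: "\<And>i j. i < s \<Longrightarrow> j < s \<Longrightarrow> ?B $$ (i, j) = A $$ (pick ?I i, pick ?J j)"
      using card by (auto simp: submatrix_def)
    have pl: "p i < s" "p' i < s" if "i < s" for i
      using that permutes_in_image[OF p(1), of i] permutes_in_image[OF p'(1), of i] by auto
    let ?C = "mat s s (\<lambda>(i, j). ?B $$ (p i, j))"
    \<comment> \<open>The column permutation is expressed as a row permutation between two
      transpositions.\<close>
    have "?M = transpose_mat (mat s s (\<lambda>(i, j). transpose_mat ?C $$ (p' i, j)))"
      using pl p(2) p'(2) by (intro eq_matI) (auto simp: Bij)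
    then have "det ?M = signof p' * det (transpose_mat ?C)"
      using p'(1) by (simp add: det_transpose[where n = s] det_permute_rows[where n = s])
    also have "\<dots> = signof p' * (signof p * det ?B)"
      using p(1) B by (simp add: det_transpose[where n = s] det_permute_rows[where n = s])
    finally have "\<bar>det ?M\<bar> = \<bar>det ?B\<bar>" by (simp add: abs_mult sign_def)
    moreover have "\<bar>det ?B\<bar> \<le> max_subdet A"
    proof -
      let ?S = "{\<bar>det (submatrix A I J)\<bar> | I J.
        I \<subseteq> {..<dim_row A} \<and> J \<subseteq> {..<dim_col A} \<and> card I = card J}"
      have "?S \<subseteq> (\<lambda>(I, J). \<bar>det (submatrix A I J)\<bar>) ` (Pow {..<dim_row A} \<times> Pow {..<dim_col A})"
        by auto
      then have "finite ?S" by (rule finite_subset) auto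
      moreover have "\<bar>det ?B\<bar> \<in> ?S"
        using f g card by (intro CollectI exI[of _ ?I] exI[of _ ?J]) auto
      ultimately show ?thesis unfolding max_subdet_def by (rule Max_ge)
    qed
    ultimately show ?thesis by simp
  qed
qed

text \<open>
  Take a nonsingular submatrix of maximal size among those using only rows orthogonal to \<open>d\<close> and
  columns from the support of \<open>d\<close>, and border it by one more such column. The cofactors along a
  further row do not depend on that row, and by maximality they are orthogonal to every row
  orthogonal to \<open>d\<close>.
\<close>

lemma ex_integral_circuit:
  fixes A :: "int mat" and d :: "nat \<Rightarrow> real"
  assumes A: "A \<in> carrier_mat m n" and d: "\<exists>i<n. d i \<noteq> 0"
  shows "\<exists>u :: nat \<Rightarrow> int. (\<exists>i<n. u i \<noteq> 0) \<and> (\<forall>i. \<bar>u i\<bar> \<le> max_subdet A) \<and>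
    (\<forall>i<n. d i = 0 \<longrightarrow> u i = 0) \<and>
    (\<forall>r<m. (\<Sum>i<n. of_int (A $$ (r, i)) * d i) = 0 \<longrightarrow> (\<Sum>i<n. A $$ (r, i) * u i) = 0)"
proof -
  define Z where "Z = {r. r < m \<and> (\<Sum>i<n. of_int (A $$ (r, i)) * d i) = 0}"
  define S where "S = {i. i < n \<and> d i \<noteq> 0}"
  \<comment> \<open>Selections are lists, so that bordering means appending and the new row and
    column come last.\<close>
  define M where "M = (\<lambda>rs cs. mat (length rs) (length rs) (\<lambda>(i, j). A $$ (rs ! i, cs ! j)))"
  define P where "P = (\<lambda>s. \<exists>rs cs. length rs = s \<and> length cs = s \<and> set rs \<subseteq> Z \<and> set cs \<subseteq> S \<and>
    det (M rs cs) \<noteq> 0)"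
  have distinct: "distinct cs" if len: "length cs = length rs" and nz: "det (M rs cs) \<noteq> 0" for rs cs
  proof (rule ccontr)
    assume "\<not> distinct cs"
    then obtain i j where ij: "i < length rs" "j < length rs" "i \<noteq> j" "cs ! i = cs ! j"
      using len by (auto simp: distinct_conv_nth)
    have "col (M rs cs) i = col (M rs cs) j"
      using ij by (intro eq_vecI) (auto simp: M_def)
    then have "det (M rs cs) = 0"
      using ij by (intro det_identical_columns[of _ "length rs" i j]) (auto simp: M_def)
    with nz show False by simp
  qed
  have "P 0" unfolding P_def by (auto simp: M_def)
  moreover have "\<not> P (Suc n)"
  proof
    assume "P (Suc n)"
    then obtain cs where "distinct cs" "length cs = Suc n" "set cs \<subseteq> S"
      unfolding P_def using distinct by metis
    then have "Suc n \<le> card S"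
      by (metis S_def card_mono distinct_card finite_Collect_conjI finite_Collect_less_nat)
    also have "\<dots> \<le> card {..<n}" unfolding S_def by (intro card_mono) auto
    finally show False by simp
  qed
  \<comment> \<open>A size at which \<open>P\<close> breaks off serves as the maximal size.\<close>
  ultimately obtain s where "P s" "\<not> P (Suc s)" by (metis nat_induct)
  then obtain rs cs where len: "length rs = s" "length cs = s" and rs: "set rs \<subseteq> Z"
    and cs: "set cs \<subseteq> S" and det: "det (M rs cs) \<noteq> 0" unfolding P_def by auto
  have dcs: "distinct cs" using distinct[of cs rs] len det by simp
  \<comment> \<open>If the whole support were used, the restriction of \<open>d\<close> to it would
    be a nonzero kernel vector of the nonsingular \<open>M rs cs\<close>, because rows in
    \<open>Z\<close> are orthogonal to \<open>d\<close>.\<close>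
  have "\<exists>c \<in> S. c \<notin> set cs"
  proof (rule ccontr)
    assume "\<not> ?thesis"
    then have S: "S = set cs" using cs by auto
    let ?R = "map_mat real_of_int (M rs cs)"
    let ?v = "vec s (\<lambda>j. d (cs ! j))"
    have R: "?R \<in> carrier_mat s s" using len by (simp add: M_def)
    have "?R *\<^sub>v ?v = 0\<^sub>v s"
    proof (rule eq_vecI)
      fix i assume "i < dim_vec (0\<^sub>v s :: real Matrix.vec)"
      then have i: "i < s" by simp
      have "(?R *\<^sub>v ?v) $ i = (\<Sum>j<s. of_int (A $$ (rs ! i, cs ! j)) * d (cs ! j))"
        using i len by (auto simp: M_def scalar_prod_def lessThan_atLeast0)
      also have "\<dots> = (\<Sum>c\<in>S. of_int (A $$ (rs ! i, c)) * d c)"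
        unfolding S using dcs len
        by (intro sum.reindex_bij_betw bij_betw_nth) auto
      also have "\<dots> = (\<Sum>c<n. of_int (A $$ (rs ! i, c)) * d c)"
        by (intro sum.mono_neutral_left) (auto simp: S_def)
      also have "\<dots> = 0"
      proof -
        have "rs ! i \<in> Z" using rs i len nth_mem[of i rs] by blast
        then show ?thesis by (simp add: Z_def)
      qed
      finally show "(?R *\<^sub>v ?v) $ i = 0\<^sub>v s $ i" using i by simp
    qed (use len in \<open>simp add: M_def\<close>)
    moreover have "?v \<noteq> 0\<^sub>v s"
    proof -
      obtain i where "i \<in> S" using d unfolding S_def by auto
      then obtain j where "j < s" "cs ! j = i" using S len by (metis in_set_conv_nth)
      then have "?v $ j \<noteq> 0\<^sub>v s $ j" using \<open>i \<in> S\<close> by (simp add: S_def)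
      then show ?thesis by metis
    qed
    ultimately have "det ?R = 0" using det_0_iff_vec_prod_zero[OF R] by (metis vec_carrier)
    with det show False by simp
  qed
  then obtain c where c: "c \<in> S" "c \<notin> set cs" by auto
  define cs' where "cs' = cs @ [c]"
  have cs': "distinct cs'" "length cs' = Suc s" "set cs' \<subseteq> S"
    using dcs c cs len by (auto simp: cs'_def)
  \<comment> \<open>Cofactors of the bordered matrix along its last row; the index shift skips
    column \<open>j\<close>.\<close>
  define C where "C = (\<lambda>j. (- 1) ^ (s + j) *
    det (mat s s (\<lambda>(i, l). A $$ (rs ! i, cs' ! (if l < j then l else Suc l)))))"
  define u where "u = (\<lambda>i. \<Sum>j<Suc s. if cs' ! j = i then C j else 0)"
  have u_nth: "u (cs' ! j) = C j" if "j < Suc s" for j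
  proof -
    have "u (cs' ! j) = (\<Sum>j'<Suc s. if j' = j then C j' else 0)"
      unfolding u_def using that cs' by (intro sum.cong) (auto simp: nth_eq_iff_index_eq)
    then show ?thesis using that by simp
  qed
  have u_zero: "u i = 0" if "i \<notin> set cs'" for i
    unfolding u_def using that cs' by (intro sum.neutral) (metis lessThan_iff nth_mem)
  have in_n: "cs' ! j < n" if "j < Suc s" for j
    proof -
    have "cs' ! j \<in> S" using that cs' nth_mem[of j cs'] by auto
    then show ?thesis by (simp add: S_def)
  qed
  have rs_m: "rs ! i < m" if "i < s" for i
    proof -
    have "rs ! i \<in> Z" using that len rs nth_mem[of i rs] by blast
    then show ?thesis by (simp add: Z_def)
  qed
  have "\<bar>C j\<bar> \<le> max_subdet A" if "j < Suc s" for j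
    unfolding C_def abs_mult using A that
    by (simp add: power_abs) (intro abs_det_reindexed_le_max_subdet, auto intro: rs_m in_n)
  then have bound: "\<bar>u i\<bar> \<le> max_subdet A" for i
    using u_nth u_zero[of i] max_subdet_ge_1[of A] cs'(2)
    by (cases "i \<in> set cs'") (auto simp: in_set_conv_nth)
  \<comment> \<open>Deleting the appended column gives back the old matrix, so \<open>u\<close> is
    nonzero at \<open>c\<close>.\<close>
  have "C s = det (M rs cs)"
  proof -
    have "mat s s (\<lambda>(i, l). A $$ (rs ! i, cs' ! (if l < s then l else Suc l))) = M rs cs"
      unfolding M_def using len by (intro eq_matI) (auto simp: cs'_def nth_append)
    then show ?thesis unfolding C_def by simp
  qed
  then have nz: "u c \<noteq> 0" using det u_nth[of s] len by (simp add: cs'_def nth_append)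
  \<comment> \<open>Laplace expansion along an appended row \<open>r\<close> turns the product of
    \<open>r\<close> with \<open>u\<close> into the determinant of a bordered matrix, which is 0 by
    the choice of \<open>s\<close>.\<close>
  have ker: "(\<Sum>i<n. A $$ (r, i) * u i) = 0" if r: "r \<in> Z" for r
  proof -
    let ?N = "M (rs @ [r]) cs'"
    have N: "?N \<in> carrier_mat (Suc s) (Suc s)" using len by (simp add: M_def)
    have "set (rs @ [r]) \<subseteq> Z" using rs r by simp
    then have "det ?N = 0" using \<open>\<not> P (Suc s)\<close> cs' len unfolding P_def
      by (metis length_append_singleton)
    moreover have "cofactor ?N s j = C j" if "j < Suc s" for j
    proof -
      have "mat_delete ?N s j = mat s s (\<lambda>(i, l). A $$ (rs ! i, cs' ! (if l < j then l else Suc l)))"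
        using that len by (intro eq_matI) (auto simp: M_def mat_delete_def nth_append)
      then show ?thesis unfolding cofactor_def C_def by simp
    qed
    moreover have "?N $$ (s, j) = A $$ (r, cs' ! j)" if "j < Suc s" for j
      using that len by (simp add: M_def nth_append)
    ultimately have "(\<Sum>j<Suc s. A $$ (r, cs' ! j) * C j) = 0"
      using laplace_expansion_row[OF N, of s] by simp
    moreover have "(\<Sum>i<n. A $$ (r, i) * u i) = (\<Sum>i\<in>set cs'. A $$ (r, i) * u i)"
      using cs'(3) u_zero by (intro sum.mono_neutral_right) (auto simp: S_def)
    moreover have "\<dots> = (\<Sum>j<Suc s. A $$ (r, cs' ! j) * u (cs' ! j))"
      using cs' by (intro sum.reindex_bij_betw[symmetric] bij_betw_nth) auto
    ultimately show ?thesis using u_nth by simp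
  qed
  show ?thesis
  proof (intro exI[of _ u] conjI allI impI)
    show "\<exists>i<n. u i \<noteq> 0" using nz c(1) unfolding S_def by auto
    show "u i = 0" if "i < n" "d i = 0" for i
      using that cs'(3) u_zero[of i] unfolding S_def by auto
  qed (use bound ker in \<open>auto simp: Z_def\<close>)
qed

section \<open>Conformal decompositions\<close>

definition row_val :: "nat \<Rightarrow> (nat \<Rightarrow> real) \<Rightarrow> (nat \<Rightarrow> real) \<Rightarrow> real" where
  "row_val n c x = (\<Sum>i<n. c i * x i)"

text \<open>Sign compatibility of \<open>u\<close> with \<open>d\<close>. A row value of
  \<open>u\<close> may vanish where that of \<open>d\<close> does not; the second conjunct excludes
  the converse, on which the product is silent.\<close>

definition conformal :: "nat \<Rightarrow> (nat \<Rightarrow> real) set \<Rightarrow> (nat \<Rightarrow> real) \<Rightarrow> (nat \<Rightarrow> real) \<Rightarrow> bool" where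
  "conformal n C u d \<longleftrightarrow> (\<forall>c\<in>C. 0 \<le> row_val n c u * row_val n c d \<and>
     (row_val n c d = 0 \<longrightarrow> row_val n c u = 0))"

lemma row_val_diff_scale: "row_val n c (\<lambda>i. x i - t * y i) = row_val n c x - t * row_val n c y"
  by (simp add: row_val_def algebra_simps sum_subtractf sum_distrib_left)

lemma row_val_uminus: "row_val n c (\<lambda>i. - x i) = - row_val n c x"
  by (simp add: row_val_def sum_negf)

lemma row_val_sum:
  "row_val n c (\<lambda>i. \<Sum>j\<in>J. t j * x j i) = (\<Sum>j\<in>J. t j * row_val n c (x j))"
proof -
  have "row_val n c (\<lambda>i. \<Sum>j\<in>J. t j * x j i) = (\<Sum>i<n. \<Sum>j\<in>J. t j * (c i * x j i))"
    by (simp add: row_val_def sum_distrib_left mult.left_commute)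
  also have "\<dots> = (\<Sum>j\<in>J. \<Sum>i<n. t j * (c i * x j i))" by (rule sum.swap)
  finally show ?thesis by (simp add: row_val_def sum_distrib_left)
qed

lemma conformal_trans:
  assumes "conformal n C u v" "conformal n C v d"
  shows "conformal n C u d"
  unfolding conformal_def
proof (intro ballI conjI impI)
  fix c assume c: "c \<in> C"
  show "row_val n c u = 0" if "row_val n c d = 0" using that assms c unfolding conformal_def by auto
  show "0 \<le> row_val n c u * row_val n c d"
  proof (cases "row_val n c v = 0")
    case True
    then show ?thesis using assms(1) c unfolding conformal_def by auto
  next
    case False
    then show ?thesis using assms c unfolding conformal_def
      by (smt (verit, best) zero_le_mult_iff)
  qed
qed

text \<open>A ratio test as in the simplex method: \<open>d\<close> moves against \<open>u\<close>
  until the first row value on which both agree in sign reaches 0. Row values of opposite sign only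
  move away from 0, and those where \<open>d\<close> vanishes stay 0 by \<open>ker\<close>.\<close>

lemma conformal_reduce:
  assumes fin: "finite C"
    and ker: "\<And>c. c \<in> C \<Longrightarrow> row_val n c d = 0 \<Longrightarrow> row_val n c u = 0"
    and pos: "\<exists>c\<in>C. 0 < row_val n c u * row_val n c d"
  shows "\<exists>t>0. conformal n C (\<lambda>i. d i - t * u i) d \<and>
    card {c \<in> C. row_val n c (\<lambda>i. d i - t * u i) \<noteq> 0} < card {c \<in> C. row_val n c d \<noteq> 0}"
proof -
  define Q where "Q = {c \<in> C. 0 < row_val n c u * row_val n c d}"
  define ratio where "ratio = (\<lambda>c. row_val n c d / row_val n c u)"
  define t where "t = Min (ratio ` Q)"
  have Q: "finite (ratio ` Q)" "ratio ` Q \<noteq> {}" using fin pos by (auto simp: Q_def)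
  obtain c0 where c0: "c0 \<in> Q" "t = ratio c0" using Min_in[OF Q] unfolding t_def by auto
  have t_le: "t \<le> ratio c" if "c \<in> Q" for c unfolding t_def using that Q by (intro Min_le) auto
  have "t > 0" using c0 unfolding Q_def ratio_def
    by (auto simp: zero_less_mult_iff zero_less_divide_iff)
  have conf: "conformal n C (\<lambda>i. d i - t * u i) d"
    unfolding conformal_def row_val_diff_scale
  proof (intro ballI conjI impI)
    fix c assume c: "c \<in> C"
    let ?a = "row_val n c d" and ?b = "row_val n c u"
    show "?a - t * ?b = 0" if "?a = 0" using that ker[OF c] by simp
    show "0 \<le> (?a - t * ?b) * ?a"
    proof (cases "c \<in> Q")
      case True
      then have pos: "0 < ?b * ?a" and "t \<le> ?a / ?b" using t_le[of c] by (auto simp: Q_def ratio_def)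
      then have "0 \<le> (?b * ?a) * (?a / ?b - t)" by simp
      also have "\<dots> = (?a - t * ?b) * ?a" using pos by (auto simp: field_simps)
      finally show ?thesis .
    next
      case False
      then have "?b * ?a \<le> 0" using c by (auto simp: Q_def)
      then have "t * (?b * ?a) \<le> 0" using \<open>t > 0\<close> by (simp add: mult_le_0_iff)
      moreover have "(?a - t * ?b) * ?a = ?a * ?a - t * (?b * ?a)" by (simp add: algebra_simps)
      ultimately show ?thesis by (metis diff_ge_0_iff_ge order_trans zero_le_square)
    qed
  qed
  moreover have "{c \<in> C. row_val n c (\<lambda>i. d i - t * u i) \<noteq> 0} \<subset> {c \<in> C. row_val n c d \<noteq> 0}"
  proof
    show "{c \<in> C. row_val n c (\<lambda>i. d i - t * u i) \<noteq> 0} \<subseteq> {c \<in> C. row_val n c d \<noteq> 0}"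
      using conf unfolding conformal_def by auto
    have "c0 \<in> {c \<in> C. row_val n c d \<noteq> 0}" using c0 by (auto simp: Q_def)
    moreover have "row_val n c0 (\<lambda>i. d i - t * u i) = 0"
      unfolding row_val_diff_scale using c0 by (auto simp: Q_def ratio_def)
    ultimately show "{c \<in> C. row_val n c (\<lambda>i. d i - t * u i) \<noteq> 0} \<noteq> {c \<in> C. row_val n c d \<noteq> 0}"
      by blast
  qed
  ultimately show ?thesis using \<open>t > 0\<close> fin by (blast intro: psubset_card_mono finite_subset)
qed

text \<open>The hypothesis \<open>circuit\<close> controls only the zeros of row values. Signs are
  repaired by induction on the number of nonzero rows: subtracting a multiple of a circuit leaves a
  vector with fewer of them that is conformal to \<open>d\<close>, and conformality is
  transitive.\<close>

lemma ex_conformal_circuit: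
  assumes fin: "finite C"
    and circuit: "\<And>d. \<exists>c\<in>C. row_val n c d \<noteq> 0 \<Longrightarrow> \<exists>u\<in>E. (\<exists>c\<in>C. row_val n c u \<noteq> 0) \<and>
      (\<forall>c\<in>C. row_val n c d = 0 \<longrightarrow> row_val n c u = 0)"
    and E: "\<And>u. u \<in> E \<Longrightarrow> (\<lambda>i. - u i) \<in> E"
    and d: "\<exists>c\<in>C. row_val n c d \<noteq> 0"
  shows "\<exists>u\<in>E. (\<exists>c\<in>C. row_val n c u \<noteq> 0) \<and> conformal n C u d"
  using d
proof (induction "card {c \<in> C. row_val n c d \<noteq> 0}" arbitrary: d rule: less_induct)
  case less
  obtain u0 c where u0: "u0 \<in> E" "c \<in> C" "row_val n c u0 \<noteq> 0"
    "\<forall>c\<in>C. row_val n c d = 0 \<longrightarrow> row_val n c u0 = 0" using circuit[OF less.prems] by blast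
  \<comment> \<open>Negation, where required, makes \<open>u\<close> agree in sign with
    \<open>d\<close> in row \<open>c\<close>, so that the ratio test applies.\<close>
  define u where "u = (if 0 < row_val n c u0 * row_val n c d then u0 else (\<lambda>i. - u0 i))"
  have "row_val n c u0 * row_val n c d \<noteq> 0" using u0 by auto
  then have u: "u \<in> E" "0 < row_val n c u * row_val n c d"
    using E[OF u0(1)] u0(1) by (auto simp: u_def row_val_uminus not_less order_le_less)
  have ker: "row_val n c u = 0" if "c \<in> C" "row_val n c d = 0" for c
    using u0(4) that by (auto simp: u_def row_val_uminus)
  obtain t where t: "t > 0" "conformal n C (\<lambda>i. d i - t * u i) d"
    "card {c \<in> C. row_val n c (\<lambda>i. d i - t * u i) \<noteq> 0} < card {c \<in> C. row_val n c d \<noteq> 0}"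
    using conformal_reduce[OF fin ker, of d] u u0(2) by blast
  show ?case
  proof (cases "\<exists>c\<in>C. row_val n c (\<lambda>i. d i - t * u i) \<noteq> 0")
    case True
    from less.hyps[OF t(3) True] show ?thesis using t(2) conformal_trans by blast
  next
    case False
    \<comment> \<open>With no remainder, \<open>d\<close> is a positive multiple of \<open>u\<close>
      on all rows, so \<open>u\<close> itself is conformal to \<open>d\<close>.\<close>
    then have d_eq: "row_val n c d = t * row_val n c u" if "c \<in> C" for c
      using that by (auto simp: row_val_diff_scale)
    then have "conformal n C u d"
      unfolding conformal_def using t(1) by (auto simp: mult.left_commute)
    moreover have "\<exists>c\<in>C. row_val n c u \<noteq> 0" using u u0(2) by force
    ultimately show ?thesis using u(1) by blast
  qed
qed

text \<open>Each subtraction annihilates a row value and leaves a remainder conformal to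
  \<open>d\<close>, so the terms found for the remainder are conformal to \<open>d\<close> as well.
  By \<open>sep\<close>, a remainder without nonzero row values is 0.\<close>

lemma conformal_decomposition:
  assumes fin: "finite C"
    and circuit: "\<And>d. \<exists>c\<in>C. row_val n c d \<noteq> 0 \<Longrightarrow> \<exists>u\<in>E. (\<exists>c\<in>C. row_val n c u \<noteq> 0) \<and>
      (\<forall>c\<in>C. row_val n c d = 0 \<longrightarrow> row_val n c u = 0)"
    and E: "\<And>u. u \<in> E \<Longrightarrow> (\<lambda>i. - u i) \<in> E"
    and sep: "\<And>d i. \<forall>c\<in>C. row_val n c d = 0 \<Longrightarrow> i < n \<Longrightarrow> d i = 0"
  shows "\<exists>(J :: nat set) t u. finite J \<and> (\<forall>j\<in>J. 0 \<le> t j \<and> u j \<in> E \<and> conformal n C (u j) d) \<and>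
    (\<forall>i<n. d i = (\<Sum>j\<in>J. t j * u j i))"
proof (induction "card {c \<in> C. row_val n c d \<noteq> 0}" arbitrary: d rule: less_induct)
  case less
  show ?case
  proof (cases "\<exists>c\<in>C. row_val n c d \<noteq> 0")
    case False
    then show ?thesis using sep[of d] by (intro exI[of _ "{}"]) auto
  next
    case True
    obtain v c where v: "v \<in> E" "c \<in> C" "row_val n c v \<noteq> 0" "conformal n C v d"
      using ex_conformal_circuit[OF fin circuit E True] by blast
    then have "0 \<le> row_val n c v * row_val n c d" "row_val n c d \<noteq> 0"
      unfolding conformal_def by auto
    with v have pos: "\<exists>c\<in>C. 0 < row_val n c v * row_val n c d"
      by (intro bexI[of _ c]) (auto simp: order_le_less)
    have ker: "row_val n c v = 0" if "c \<in> C" "row_val n c d = 0" for c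
      using v(4) that by (auto simp: conformal_def)
    obtain s where s: "s > 0" "conformal n C (\<lambda>i. d i - s * v i) d"
      "card {c \<in> C. row_val n c (\<lambda>i. d i - s * v i) \<noteq> 0} < card {c \<in> C. row_val n c d \<noteq> 0}"
      using conformal_reduce[OF fin ker pos] by blast
    obtain J :: "nat set" and t u where J: "finite J"
      "\<forall>j\<in>J. 0 \<le> t j \<and> u j \<in> E \<and> conformal n C (u j) (\<lambda>i. d i - s * v i)"
      "\<forall>i<n. d i - s * v i = (\<Sum>j\<in>J. t j * u j i)" using less[OF s(3)] by blast
    obtain l where l: "l \<notin> J" using J(1) ex_new_if_finite infinite_UNIV_nat by blast
    let ?t = "t(l := s)" and ?u = "u(l := v)"
    have sum: "(\<Sum>j\<in>insert l J. ?t j * ?u j i) = s * v i + (\<Sum>j\<in>J. t j * u j i)" for i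
    proof -
      have "(\<Sum>j\<in>J. ?t j * ?u j i) = (\<Sum>j\<in>J. t j * u j i)"
        using l by (intro sum.cong) auto
      then show ?thesis using J(1) l by simp
    qed
    have "d i = (\<Sum>j\<in>insert l J. ?t j * ?u j i)" if "i < n" for i
      unfolding sum using J(3) that by (metis add_diff_cancel_left' diff_add_cancel add.commute)
    moreover have "0 \<le> ?t j \<and> ?u j \<in> E \<and> conformal n C (?u j) d" if "j \<in> insert l J" for j
      using that J(2) s v conformal_trans[OF _ s(2)] by auto
    ultimately show ?thesis using J(1)
      by (intro exI[of _ "insert l J"] exI[of _ ?t] exI[of _ ?u]) simp
  qed
qed

section \<open>The conic Caratheodory theorem\<close>

lemma ex_linear_dependence:
  fixes u :: "'j \<Rightarrow> nat \<Rightarrow> real"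
  assumes fin: "finite J" and card: "n < card J"
  shows "\<exists>c. (\<exists>j\<in>J. 0 < c j) \<and> (\<forall>i<n. (\<Sum>j\<in>J. c j * u j i) = 0)"
proof -
  define p where "p = card J"
  obtain h where h: "bij_betw h {..<p} J"
    using ex_bij_betw_nat_finite[OF fin] unfolding p_def lessThan_atLeast0 by blast
  \<comment> \<open>The vectors are the columns, padded with zero rows to a square matrix; as
    \<open>n < p\<close>, the last row is 0 and the determinant vanishes.\<close>
  let ?M = "mat p p (\<lambda>(i, j). if i < n then u (h j) i else 0)"
  have M: "?M \<in> carrier_mat p p" by simp
  have "row ?M (p - 1) = 0\<^sub>v p"
    using card unfolding p_def by (intro eq_vecI) auto
  then have "det ?M = 0" using laplace_expansion_row[OF M, of "p - 1"] card
    by (auto simp: p_def intro!: sum.neutral)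
  then obtain v where v: "v \<in> carrier_vec p" "v \<noteq> 0\<^sub>v p" "?M *\<^sub>v v = 0\<^sub>v p"
    using det_0_iff_vec_prod_zero[OF M] by blast
  have zero: "(\<Sum>j<p. v $ j * u (h j) i) = 0" if "i < n" for i
  proof -
    have "i < p" using that card by (simp add: p_def)
    then have "(?M *\<^sub>v v) $ i = (\<Sum>j<p. v $ j * u (h j) i)"
      using that v(1) by (auto simp: scalar_prod_def lessThan_atLeast0 mult.commute intro!: sum.cong)
    then show ?thesis using v(3) \<open>i < p\<close> by simp
  qed
  obtain j0 where j0: "j0 < p" "v $ j0 \<noteq> 0"
    using v(1,2) by (metis carrier_vecD eq_vecI index_zero_vec(1) index_zero_vec(2))
  define c where "c = (\<lambda>j. sgn (v $ j0) * v $ (the_inv_into {..<p} h j))"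
  have inv: "the_inv_into {..<p} h (h j) = j" if "j < p" for j
    using h that by (intro the_inv_into_f_f) (auto simp: bij_betw_def)
  have "(\<Sum>j\<in>J. c j * u j i) = 0" if "i < n" for i
  proof -
    have "(\<Sum>j\<in>J. c j * u j i) = (\<Sum>j<p. c (h j) * u (h j) i)"
      by (rule sum.reindex_bij_betw[OF h, symmetric])
    also have "\<dots> = sgn (v $ j0) * (\<Sum>j<p. v $ j * u (h j) i)"
      by (simp add: sum_distrib_left c_def inv mult.assoc)
    finally show ?thesis using zero[OF that] by simp
  qed
  moreover have "0 < c (h j0)" "h j0 \<in> J"
    using j0 h by (auto simp: c_def inv sgn_if bij_betw_def)
  ultimately show ?thesis by blast
qed

text \<open>Subtracting the largest multiple of a linear dependence that keeps all coefficients
  nonnegative removes a term. Only coefficients change, so the surviving vectors stay integral,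
  bounded and conformal.\<close>

lemma conic_caratheodory:
  fixes u :: "'j \<Rightarrow> nat \<Rightarrow> real"
  assumes "finite J" and "\<forall>j\<in>J. 0 \<le> t j"
  shows "\<exists>J' t'. J' \<subseteq> J \<and> card J' \<le> n \<and> (\<forall>j\<in>J'. 0 \<le> t' j) \<and>
    (\<forall>i<n. (\<Sum>j\<in>J'. t' j * u j i) = (\<Sum>j\<in>J. t j * u j i))"
  using assms
proof (induction "card J" arbitrary: J t rule: less_induct)
  case less
  show ?case
  proof (cases "card J \<le> n")
    case True
    then show ?thesis using less.prems by (intro exI[of _ J] exI[of _ t]) simp
  next
    case False
    then obtain c j1 where c: "j1 \<in> J" "0 < c j1" "\<forall>i<n. (\<Sum>j\<in>J. c j * u j i) = 0"
      using ex_linear_dependence[OF less.prems(1), of n u] by auto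
    define Q where "Q = {j \<in> J. 0 < c j}"
    define s where "s = Min ((\<lambda>j. t j / c j) ` Q)"
    have Q: "finite ((\<lambda>j. t j / c j) ` Q)" "(\<lambda>j. t j / c j) ` Q \<noteq> {}"
      using less.prems c by (auto simp: Q_def)
    obtain j0 where j0: "j0 \<in> Q" "s = t j0 / c j0" using Min_in[OF Q] unfolding s_def by auto
    have s_le: "s \<le> t j / c j" if "j \<in> Q" for j unfolding s_def using that Q by (intro Min_le) auto
    have "0 \<le> s" using j0 less.prems(2) by (auto simp: Q_def)
    define t' where "t' = (\<lambda>j. t j - s * c j)"
    have nonneg: "0 \<le> t' j" if "j \<in> J" for j
    proof (cases "j \<in> Q")
      case True
      then show ?thesis using s_le[OF True] by (auto simp: t'_def Q_def field_simps)
    next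
      case False
      then have "s * c j \<le> 0" using that \<open>0 \<le> s\<close> by (auto simp: Q_def mult_le_0_iff)
      then show ?thesis using less.prems(2) that unfolding t'_def by force
    qed
    have "t' j0 = 0" "j0 \<in> J" using j0 by (auto simp: t'_def Q_def)
    have sum: "(\<Sum>j\<in>J - {j0}. t' j * u j i) = (\<Sum>j\<in>J. t j * u j i)" if "i < n" for i
    proof -
      have "(\<Sum>j\<in>J - {j0}. t' j * u j i) = (\<Sum>j\<in>J. t' j * u j i)"
        using \<open>t' j0 = 0\<close> less.prems(1) by (simp add: sum_diff1)
      also have "\<dots> = (\<Sum>j\<in>J. t j * u j i) - s * (\<Sum>j\<in>J. c j * u j i)"
        by (simp add: t'_def algebra_simps sum_subtractf sum_distrib_left)
      finally show ?thesis using c(3) that by simp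
    qed
    have "card (J - {j0}) < card J"
      using \<open>j0 \<in> J\<close> less.prems(1) by (intro psubset_card_mono) auto
    moreover have "finite (J - {j0})" "\<forall>j\<in>J - {j0}. 0 \<le> t' j" using less.prems(1) nonneg by auto
    ultimately have "\<exists>J' t''. J' \<subseteq> J - {j0} \<and> card J' \<le> n \<and> (\<forall>j\<in>J'. 0 \<le> t'' j) \<and>
      (\<forall>i<n. (\<Sum>j\<in>J'. t'' j * u j i) = (\<Sum>j\<in>J - {j0}. t' j * u j i))"
      by (rule less.hyps)
    then obtain J' t'' where "J' \<subseteq> J - {j0}" "card J' \<le> n" "\<forall>j\<in>J'. 0 \<le> t'' j"
      "\<forall>i<n. (\<Sum>j\<in>J'. t'' j * u j i) = (\<Sum>j\<in>J - {j0}. t' j * u j i)"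
      by (elim exE conjE)
    then show ?thesis using sum by (intro exI[of _ J'] exI[of _ t'']) auto
  qed
qed

text \<open>The rows of \<open>A\<close> are joined by the unit rows \<open>e i\<close>. These turn
  conformality into sign agreement in every coordinate and provide the separation property of the
  decomposition.\<close>

lemma integral_conformal_decomposition:
  fixes A :: "int mat" and d :: "nat \<Rightarrow> real"
  assumes A: "A \<in> carrier_mat m n"
  shows "\<exists>(J :: nat set) t u. finite J \<and> card J \<le> n \<and> (\<forall>i<n. d i = (\<Sum>j\<in>J. t j * u j i)) \<and>
    (\<forall>j\<in>J. 0 \<le> t j \<and>
      (\<forall>i<n. u j i \<in> \<int> \<and> \<bar>u j i\<bar> \<le> max_subdet A \<and> u j i = sgn (d i) * \<bar>u j i\<bar>) \<and>
      (\<forall>r<m. let R = row_val n (\<lambda>i. A $$ (r, i)) in 0 \<le> R (u j) * R d \<and> (R d = 0 \<longrightarrow> R (u j) = 0)))"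
proof -
  define a where "a = (\<lambda>r i. real_of_int (A $$ (r, i)))"
  define e where "e = (\<lambda>i l :: nat. if l = i then 1 else 0 :: real)"
  define C where "C = a ` {..<m} \<union> e ` {..<n}"
  define E where "E = {u. \<forall>i<n. u i \<in> \<int> \<and> \<bar>u i\<bar> \<le> real_of_int (max_subdet A)}"
  have fin: "finite C" by (simp add: C_def)
  have row_e: "row_val n (e i) x = x i" if "i < n" for i x
  proof -
    have "row_val n (e i) x = (\<Sum>l<n. if l = i then x l else 0)"
      unfolding row_val_def e_def by (intro sum.cong) auto
    then show ?thesis using that by simp
  qed
  have sep: "x i = 0" if "\<forall>c\<in>C. row_val n c x = 0" "i < n" for x i
    using that row_e[of i x] by (auto simp: C_def)
  have circuit: "\<exists>u\<in>E. (\<exists>c\<in>C. row_val n c u \<noteq> 0) \<and> (\<forall>c\<in>C. row_val n c x = 0 \<longrightarrow> row_val n c u = 0)"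
    if "\<exists>c\<in>C. row_val n c x \<noteq> 0" for x
  proof -
    have "\<exists>i<n. x i \<noteq> 0"
    proof (rule ccontr)
      assume "\<not> ?thesis"
      then have "row_val n c x = 0" for c by (simp add: row_val_def)
      with that show False by simp
    qed
    from ex_integral_circuit[OF A this] obtain u :: "nat \<Rightarrow> int" where u:
      "\<exists>i<n. u i \<noteq> 0" "\<forall>i. \<bar>u i\<bar> \<le> max_subdet A" "\<forall>i<n. x i = 0 \<longrightarrow> u i = 0"
      "\<forall>r<m. (\<Sum>i<n. of_int (A $$ (r, i)) * x i) = 0 \<longrightarrow> (\<Sum>i<n. A $$ (r, i) * u i) = 0"
      by blast
    let ?u = "\<lambda>i. real_of_int (u i)"
    have "\<bar>?u i\<bar> \<le> real_of_int (max_subdet A)" for i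
      using u(2) by (metis of_int_abs of_int_le_iff)
    then have "?u \<in> E" by (simp add: E_def)
    moreover obtain i where "i < n" "u i \<noteq> 0" using u(1) by blast
    then have "\<exists>c\<in>C. row_val n c ?u \<noteq> 0"
      using row_e[of i ?u] by (intro bexI[of _ "e i"]) (auto simp: C_def)
    moreover have "row_val n c ?u = 0" if "c \<in> C" "row_val n c x = 0" for c
      using that(1) unfolding C_def
    proof
      assume "c \<in> a ` {..<m}"
      then obtain r where r: "r < m" "c = a r" by auto
      then have "(\<Sum>i<n. A $$ (r, i) * u i) = 0" using u(4) that(2) by (simp add: row_val_def a_def)
      then have "real_of_int (\<Sum>i<n. A $$ (r, i) * u i) = 0" by simp
      then show ?thesis using r by (simp add: row_val_def a_def)
    next
      assume "c \<in> e ` {..<n}"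
      then show ?thesis using u(3) that(2) row_e by auto
    qed
    ultimately show ?thesis by blast
  qed
  have neg: "(\<lambda>i. - u i) \<in> E" if "u \<in> E" for u using that by (auto simp: E_def)
  have "\<exists>(J :: nat set) t u. finite J \<and>
      (\<forall>j\<in>J. 0 \<le> t j \<and> u j \<in> E \<and> conformal n C (u j) d) \<and> (\<forall>i<n. d i = (\<Sum>j\<in>J. t j * u j i))"
    by (rule conformal_decomposition) (fact fin circuit neg sep)+
  then obtain J0 :: "nat set" and t0 u where J0: "finite J0"
    "\<forall>j\<in>J0. 0 \<le> t0 j \<and> u j \<in> E \<and> conformal n C (u j) d"
    "\<forall>i<n. d i = (\<Sum>j\<in>J0. t0 j * u j i)"
    by (elim exE conjE)
  obtain J t where J: "J \<subseteq> J0" "card J \<le> n" "\<forall>j\<in>J. 0 \<le> t j"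
    "\<forall>i<n. (\<Sum>j\<in>J. t j * u j i) = (\<Sum>j\<in>J0. t0 j * u j i)"
    using conic_caratheodory[of J0 t0 n u] J0(1,2) by auto
  have conf: "0 \<le> row_val n c (u j) * row_val n c d"
    "row_val n c d = 0 \<Longrightarrow> row_val n c (u j) = 0" if "j \<in> J" "c \<in> C" for j c
    using J0(2) J(1) that unfolding conformal_def by auto
  have sgn: "u j i = sgn (d i) * \<bar>u j i\<bar>" if "j \<in> J" "i < n" for j i
  proof -
    have "0 \<le> u j i * d i" "d i = 0 \<Longrightarrow> u j i = 0"
      using conf[OF that(1), of "e i"] that(2) by (auto simp: C_def row_e)
    then show ?thesis by (auto simp: sgn_if abs_if zero_le_mult_iff)
  qed
  have "u j i \<in> \<int> \<and> \<bar>u j i\<bar> \<le> max_subdet A \<and> u j i = sgn (d i) * \<bar>u j i\<bar>"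
    if "j \<in> J" "i < n" for j i
    using J0(2) J(1) that sgn[OF that] unfolding E_def by blast
  moreover have "0 \<le> row_val n (a r) (u j) * row_val n (a r) d \<and>
      (row_val n (a r) d = 0 \<longrightarrow> row_val n (a r) (u j) = 0)" if "j \<in> J" "r < m" for j r
    using conf[of j "a r"] that by (simp add: C_def)
  moreover have "\<forall>i<n. d i = (\<Sum>j\<in>J. t j * u j i)" using J(4) J0(3) by simp
  ultimately show ?thesis
    using J(2,3) finite_subset[OF J(1) J0(1)] unfolding a_def Let_def
    by (intro exI[of _ J] exI[of _ t] exI[of _ u] conjI) blast+
qed

section \<open>Near and far coordinates\<close>

text \<open>All summands share the sign of \<open>D\<close>, so lowering the coefficients keeps the
  sum between 0 and \<open>D\<close>.\<close>

lemma conformal_partial_sum_bounds: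
  fixes \<rho> \<kappa> t :: "'j \<Rightarrow> real"
  assumes "(\<Sum>j\<in>J. t j * \<rho> j) = D"
    and "\<And>j. j \<in> J \<Longrightarrow> 0 \<le> \<kappa> j \<and> \<kappa> j \<le> t j"
    and "\<And>j. j \<in> J \<Longrightarrow> 0 \<le> \<rho> j * D \<and> (D = 0 \<longrightarrow> \<rho> j = 0)"
  shows "min 0 D \<le> (\<Sum>j\<in>J. \<kappa> j * \<rho> j)" and "(\<Sum>j\<in>J. \<kappa> j * \<rho> j) \<le> max 0 D"
proof -
  consider "D = 0" | "D > 0" | "D < 0" by linarith
  then have "min 0 D \<le> (\<Sum>j\<in>J. \<kappa> j * \<rho> j) \<and> (\<Sum>j\<in>J. \<kappa> j * \<rho> j) \<le> max 0 D"
  proof cases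
    case 1
    then have "(\<Sum>j\<in>J. \<kappa> j * \<rho> j) = 0" using assms(3) by (intro sum.neutral) auto
    then show ?thesis using 1 by simp
  next
    case 2
    then have "0 \<le> \<rho> j" if "j \<in> J" for j using assms(3)[OF that] by (simp add: zero_le_mult_iff)
    then have "0 \<le> (\<Sum>j\<in>J. \<kappa> j * \<rho> j)" "(\<Sum>j\<in>J. \<kappa> j * \<rho> j) \<le> (\<Sum>j\<in>J. t j * \<rho> j)"
      using assms(2) by (auto intro!: sum_nonneg sum_mono mult_right_mono)
    then show ?thesis using 2 assms(1) by simp
  next
    case 3
    then have "\<rho> j \<le> 0" if "j \<in> J" for j using assms(3)[OF that] by (simp add: zero_le_mult_iff)
    then have "(\<Sum>j\<in>J. \<kappa> j * \<rho> j) \<le> 0" "(\<Sum>j\<in>J. t j * \<rho> j) \<le> (\<Sum>j\<in>J. \<kappa> j * \<rho> j)"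
      using assms(2) by (auto intro!: sum_nonpos sum_mono mult_right_mono_neg mult_nonneg_nonpos)
    then show ?thesis using 3 assms(1) by simp
  qed
  then show "min 0 D \<le> (\<Sum>j\<in>J. \<kappa> j * \<rho> j)" "(\<Sum>j\<in>J. \<kappa> j * \<rho> j) \<le> max 0 D" by auto
qed

text \<open>
  A maximal set satisfying the first inequality satisfies the second one, as otherwise the violating
  coordinate could be added.
\<close>

lemma ex_near_coordinates:
  fixes D :: "nat \<Rightarrow> real"
  assumes "0 \<le> c"
  shows "\<exists>I\<subseteq>{..<k}. N + sum D I \<le> N * (c + 1) ^ card I \<and>
    (\<forall>i\<in>{..<k} - I. c * (N + sum D I) \<le> D i)"
proof -
  define F where "F = {I \<in> Pow {..<k}. N + sum D I \<le> N * (c + 1) ^ card I}"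
  have "finite F" by (simp add: F_def)
  moreover have "{} \<in> F" by (simp add: F_def)
  then have "F \<noteq> {}" by blast
  ultimately have "\<exists>I\<in>F. \<forall>I'\<in>F. I \<le> I' \<longrightarrow> I = I'" by (rule finite_has_maximal)
  then obtain I where "I \<in> F" and max: "\<And>I'. I' \<in> F \<Longrightarrow> I \<subseteq> I' \<Longrightarrow> I = I'" by blast
  then have I: "I \<subseteq> {..<k}" "N + sum D I \<le> N * (c + 1) ^ card I" by (auto simp: F_def)
  have fin: "finite I" using I(1) finite_subset by auto
  have "c * (N + sum D I) \<le> D i" if i: "i \<in> {..<k} - I" for i
  proof (rule ccontr)
    assume "\<not> ?thesis"
    then have "N + sum D (insert i I) \<le> (c + 1) * (N + sum D I)"
      using i fin by (simp add: algebra_simps)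
    also have "\<dots> \<le> (c + 1) * (N * (c + 1) ^ card I)"
      using I(2) assms by (intro mult_left_mono) auto
    also have "\<dots> = N * (c + 1) ^ card (insert i I)" using i fin by simp
    finally have "insert i I \<in> F" using I(1) i by (simp add: F_def)
    with max[of "insert i I"] i show False by auto
  qed
  then show ?thesis using I by (intro exI[of _ I]) auto
qed

text \<open>The source of the constant 10. With \<open>V = a + b\<close>, the hypotheses give
  \<open>V + W <= 10/9 V\<close>, so \<open>W <= \<epsilon> V / 9\<close> and
  \<open>|b - a| <= V / 9\<close>. Hence \<open>4 a b = V^2 - (b - a)^2 >= 80/81 V^2\<close>, more
  than the required \<open>8/9 V^2\<close>.\<close>

lemma far_coordinate_estimate:
  fixes a b W \<epsilon> :: real
  assumes "0 < \<epsilon>" "\<epsilon> \<le> 1" and "0 \<le> W" "0 \<le> a + b"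
    and W: "W \<le> \<epsilon> * (a + b + W) / 10" and ab: "\<bar>b - a\<bar> \<le> (a + b + W) / 10"
  shows "2 * (a + b) * W \<le> \<epsilon> * (a * b)"
proof -
  define V where "V = a + b"
  have "\<epsilon> * (V + W) \<le> 1 * (V + W)" using assms by (intro mult_right_mono) (auto simp: V_def)
  then have DV: "V + W \<le> 10 / 9 * V" using W by (simp add: V_def)
  have "\<epsilon> * (V + W) \<le> \<epsilon> * (10 / 9 * V)" using DV assms(1) by (intro mult_left_mono) auto
  then have "W \<le> \<epsilon> * (10 / 9 * V) / 10" using W unfolding V_def[symmetric] by linarith
  then have "2 * V * W \<le> 2 * V * (\<epsilon> * (10 / 9 * V) / 10)"
    using assms(4) by (intro mult_left_mono) (auto simp: V_def)
  also have "\<dots> = \<epsilon> * (2 / 9 * V\<^sup>2)" by (simp add: power2_eq_square)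
  also have "\<dots> \<le> \<epsilon> * (a * b)"
  proof (rule mult_left_mono)
    have "\<bar>b - a\<bar> \<le> \<bar>V / 9\<bar>" using ab DV assms(4) by (simp add: V_def)
    then have "(b - a)\<^sup>2 \<le> (V / 9)\<^sup>2" by (simp only: abs_le_square_iff)
    moreover have "(V / 9)\<^sup>2 = V\<^sup>2 / 81" by (simp add: power_divide)
    moreover have "(b - a)\<^sup>2 = V\<^sup>2 - 4 * (a * b)" by (simp add: V_def power2_eq_square algebra_simps)
    moreover have "0 \<le> V\<^sup>2" by simp
    ultimately show "2 / 9 * V\<^sup>2 \<le> a * b" by linarith
  qed (use assms in simp)
  finally show ?thesis by (simp add: V_def)
qed

text \<open>Here \<open>a + b\<close> is the integral part \<open>v\<close> and \<open>w\<close> the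
  rest. Each of \<open>a\<close>, \<open>b\<close> and \<open>a + b\<close> uses coefficients
  between 0 and those of \<open>d\<close>, whence the row bounds for all three.\<close>

lemma ex_proximity_splitting:
  fixes A :: "int mat" and d :: "nat \<Rightarrow> real" and \<epsilon> :: real
  assumes A: "A \<in> carrier_mat m n" and k: "k \<le> n" and eps: "0 < \<epsilon>" "\<epsilon> \<le> 1"
  shows "\<exists>a b w. (\<forall>i<n. a i \<in> \<int> \<and> b i \<in> \<int> \<and> d i = a i + b i + w i \<and>
      \<bar>w i\<bar> \<le> real n * real_of_int (max_subdet A) * (10 * real_of_int (max_subdet A) / \<epsilon> + 1) ^ k) \<and>
    (\<forall>i<k. 2 * ((a i + b i) * w i) \<le> \<epsilon> * (a i * b i)) \<and>
    (\<forall>r<m. \<forall>s\<in>{a, b, \<lambda>i. a i + b i}. let R = row_val n (\<lambda>i. A $$ (r, i)) in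
      min 0 (R d) \<le> R s \<and> R s \<le> max 0 (R d))"
proof -
  define \<Delta> where "\<Delta> = real_of_int (max_subdet A)"
  have \<Delta>: "\<Delta> \<ge> 1" using max_subdet_ge_1[of A] by (simp add: \<Delta>_def)
  \<comment> \<open>Chosen so that far coordinates satisfy
    \<open>\<Delta> * N <= \<epsilon> * |d i| / 10\<close>.\<close>
  define c where "c = 10 * \<Delta> / \<epsilon>"
  have c: "c \<ge> 0" using \<Delta> eps by (simp add: c_def)
  obtain J :: "nat set" and t u where J: "finite J" "card J \<le> n"
    and d: "\<forall>i<n. d i = (\<Sum>j\<in>J. t j * u j i)"
    and J_props: "\<forall>j\<in>J. 0 \<le> t j \<and>
      (\<forall>i<n. u j i \<in> \<int> \<and> \<bar>u j i\<bar> \<le> \<Delta> \<and> u j i = sgn (d i) * \<bar>u j i\<bar>) \<and>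
      (\<forall>r<m. let R = row_val n (\<lambda>i. A $$ (r, i)) in 0 \<le> R (u j) * R d \<and> (R d = 0 \<longrightarrow> R (u j) = 0))"
    using integral_conformal_decomposition[OF A, of d] unfolding \<Delta>_def by (elim exE conjE)
  have t: "0 \<le> t j" if "j \<in> J" for j using J_props that by blast
  have u: "u j i \<in> \<int> \<and> \<bar>u j i\<bar> \<le> \<Delta> \<and> u j i = sgn (d i) * \<bar>u j i\<bar>" if "j \<in> J" "i < n" for j i
    using J_props that by blast
  have rows: "0 \<le> row_val n (\<lambda>i. A $$ (r, i)) (u j) * row_val n (\<lambda>i. A $$ (r, i)) d \<and>
      (row_val n (\<lambda>i. A $$ (r, i)) d = 0 \<longrightarrow> row_val n (\<lambda>i. A $$ (r, i)) (u j) = 0)"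
    if "j \<in> J" "r < m" for j r
    using J_props that unfolding Let_def by blast
  obtain I where I: "I \<subseteq> {..<k}"
    and N_le: "real n + (\<Sum>i\<in>I. \<bar>d i\<bar>) \<le> real n * (c + 1) ^ card I"
    and far: "\<And>i. i < k \<Longrightarrow> i \<notin> I \<Longrightarrow> c * (real n + (\<Sum>i\<in>I. \<bar>d i\<bar>)) \<le> \<bar>d i\<bar>"
    using ex_near_coordinates[OF c, of k "real n" "\<lambda>i. \<bar>d i\<bar>"] by auto
  define N where "N = real n + (\<Sum>i\<in>I. \<bar>d i\<bar>)"
  have "0 \<le> (\<Sum>i\<in>I. \<bar>d i\<bar>)" by (rule sum_nonneg) simp
  then have n_le_N: "real n \<le> N" by (simp add: N_def)
  define near where "near = (\<lambda>j. \<exists>i\<in>I. u j i \<noteq> 0)"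
  define \<mu> where "\<mu> = (\<lambda>j. if near j then 0 else \<lfloor>t j\<rfloor>)"
  \<comment> \<open>Halving coefficient by coefficient keeps both halves integral, with
    \<open>\<beta> j\<close> exceeding \<open>\<alpha> j\<close> by at most 1.\<close>
  define \<alpha> where "\<alpha> = (\<lambda>j. real_of_int (\<mu> j div 2))"
  define \<beta> where "\<beta> = (\<lambda>j. real_of_int (\<mu> j - \<mu> j div 2))"
  define \<omega> where "\<omega> = (\<lambda>j. t j - \<mu> j)"
  \<comment> \<open>Sign agreement rules out cancellation within a coordinate: \<open>comb\<close>
    is \<open>mag\<close> times the sign of \<open>d i\<close>, so the estimates can be made for
    \<open>mag\<close>.\<close>
  define comb where "comb = (\<lambda>\<kappa> i. \<Sum>j\<in>J. \<kappa> j * u j i)"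
  define mag where "mag = (\<lambda>\<kappa> i. \<Sum>j\<in>J. \<kappa> j * \<bar>u j i\<bar>)"
  have \<mu>: "0 \<le> \<mu> j" "\<mu> j \<le> t j" if "j \<in> J" for j using t[OF that] by (auto simp: \<mu>_def)
  have ab_diff: "0 \<le> \<beta> j - \<alpha> j" "\<beta> j - \<alpha> j \<le> 1" for j
  proof -
    have "0 \<le> (\<mu> j - \<mu> j div 2) - \<mu> j div 2" "(\<mu> j - \<mu> j div 2) - \<mu> j div 2 \<le> 1" by presburger+
    then show "0 \<le> \<beta> j - \<alpha> j" "\<beta> j - \<alpha> j \<le> 1" unfolding \<alpha>_def \<beta>_def by linarith+
  qed
  have \<alpha>\<beta>: "\<alpha> j + \<beta> j = \<mu> j" for j by (simp add: \<alpha>_def \<beta>_def)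
  have \<alpha>: "0 \<le> \<alpha> j" if "j \<in> J" for j using \<mu>[OF that] by (simp add: \<alpha>_def)
  have \<beta>: "0 \<le> \<beta> j" if "j \<in> J" for j using \<alpha>[OF that] ab_diff[of j] by simp
  have \<omega>: "0 \<le> \<omega> j" if "j \<in> J" for j using \<mu>[OF that] by (simp add: \<omega>_def)
  have comb: "comb \<kappa> i = sgn (d i) * mag \<kappa> i" if "i < n" for \<kappa> i
  proof -
    have "comb \<kappa> i = (\<Sum>j\<in>J. \<kappa> j * (sgn (d i) * \<bar>u j i\<bar>))"
      unfolding comb_def using u that by (intro sum.cong) auto
    then show ?thesis by (simp add: mag_def sum_distrib_left mult.left_commute)
  qed
  have mag_nonneg: "0 \<le> mag \<kappa> i" if "\<And>j. j \<in> J \<Longrightarrow> 0 \<le> \<kappa> j" for \<kappa> i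
    unfolding mag_def using that by (intro sum_nonneg) auto
  have mag_d: "mag \<alpha> i + mag \<beta> i + mag \<omega> i = \<bar>d i\<bar>" if "i < n" for i
  proof -
    have "\<alpha> j + \<beta> j + \<omega> j = t j" for j using \<alpha>\<beta>[of j] by (simp add: \<omega>_def)
    then have eq: "mag \<alpha> i + mag \<beta> i + mag \<omega> i = mag t i"
      unfolding mag_def sum.distrib[symmetric] distrib_right[symmetric] by simp
    have "d i = sgn (d i) * mag t i" using d that comb[OF that, of t] by (simp add: comb_def)
    moreover have "0 \<le> mag t i" using t by (intro mag_nonneg)
    ultimately have "mag t i = \<bar>d i\<bar>" if "d i \<noteq> 0" using that
      by (metis abs_mult abs_of_nonneg abs_sgn_eq_1 mult_1)
    moreover have "mag t i = 0" if "d i = 0"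
      unfolding mag_def using u \<open>i < n\<close> that by (intro sum.neutral) fastforce
    ultimately show ?thesis unfolding eq by (cases "d i = 0") auto
  qed
  have d_split: "d i = comb \<alpha> i + comb \<beta> i + comb \<omega> i" if "i < n" for i
    unfolding comb[OF that] distrib_left[symmetric] mag_d[OF that] by (simp add: sgn_mult_abs)
  have mag_\<omega>: "mag \<omega> i \<le> \<Delta> * N" if i: "i < n" for i
  proof -
    \<comment> \<open>By integrality, a near \<open>u j\<close> contributes at least
      \<open>t j\<close> to some coordinate in \<open>I\<close>, and the contributions there add up
      to \<open>|d i|\<close> without cancellation.\<close>
    have near_sum: "(\<Sum>j\<in>{j \<in> J. near j}. t j) \<le> (\<Sum>i\<in>I. \<bar>d i\<bar>)"
    proof -
      have "(\<Sum>j\<in>{j \<in> J. near j}. t j) \<le> (\<Sum>j\<in>{j \<in> J. near j}. \<Sum>i\<in>I. t j * \<bar>u j i\<bar>)"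
      proof (rule sum_mono)
        fix j assume j: "j \<in> {j \<in> J. near j}"
        then obtain l where l: "l \<in> I" "u j l \<noteq> 0" by (auto simp: near_def)
        then have "l < n" using I k by auto
        then have "1 \<le> \<bar>u j l\<bar>" using u[of j l] j l by (auto intro: Ints_nonzero_abs_ge1)
        then have "t j * 1 \<le> t j * \<bar>u j l\<bar>" using t j by (intro mult_left_mono) auto
        also have "\<dots> \<le> (\<Sum>i\<in>I. t j * \<bar>u j i\<bar>)"
          using l I t j finite_subset[OF I] by (intro member_le_sum) auto
        finally show "t j \<le> (\<Sum>i\<in>I. t j * \<bar>u j i\<bar>)" by simp
      qed
      also have "\<dots> \<le> (\<Sum>j\<in>J. \<Sum>i\<in>I. t j * \<bar>u j i\<bar>)"
        using J t by (intro sum_mono2) (auto intro!: sum_nonneg)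
      also have "\<dots> = (\<Sum>i\<in>I. mag t i)" unfolding mag_def by (rule sum.swap)
      also have "\<dots> = (\<Sum>i\<in>I. \<bar>d i\<bar>)"
      proof (rule sum.cong)
        fix i assume "i \<in> I"
        then have "i < n" using I k by auto
        have "mag \<alpha> i + mag \<beta> i + mag \<omega> i = mag t i"
          unfolding mag_def sum.distrib[symmetric] distrib_right[symmetric] using \<alpha>\<beta>
          by (simp add: \<omega>_def)
        then show "mag t i = \<bar>d i\<bar>" using mag_d[OF \<open>i < n\<close>] by simp
      qed simp
      finally show ?thesis .
    qed
    have "mag \<omega> i \<le> (\<Sum>j\<in>J. \<omega> j * \<Delta>)"
      unfolding mag_def using u i \<omega> by (intro sum_mono mult_left_mono) auto
    also have "\<dots> = \<Delta> * (\<Sum>j\<in>J. \<omega> j)" by (simp add: sum_distrib_left mult.commute)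
    \<comment> \<open>The remainder is all of \<open>t j\<close> for near \<open>j\<close> and a
      fractional part otherwise; the bound \<open>card J <= n\<close> accounts for the summand
      \<open>real n\<close> of \<open>N\<close>.\<close>
    also have "(\<Sum>j\<in>J. \<omega> j) \<le> (\<Sum>j\<in>J. (if near j then t j else 0) + 1)"
      by (intro sum_mono) (auto simp: \<omega>_def \<mu>_def, linarith)
    also have "\<dots> = (\<Sum>j\<in>{j \<in> J. near j}. t j) + card J"
      using J by (simp add: sum.distrib sum.inter_filter)
    also have "\<dots> \<le> N" using near_sum J(2) by (simp add: N_def)
    finally show ?thesis using \<Delta> by (simp add: mult_left_mono)
  qed
  have "(c + 1) ^ card I \<le> (c + 1) ^ k"
    using card_mono[OF _ I] c by (intro power_increasing) auto
  then have "real n * (c + 1) ^ card I \<le> real n * (c + 1) ^ k" by (intro mult_left_mono) auto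
  then have "\<Delta> * N \<le> \<Delta> * (real n * (c + 1) ^ k)"
    using N_le \<Delta> by (intro mult_left_mono) (auto simp: N_def)
  then have dist: "\<bar>comb \<omega> i\<bar> \<le> real n * \<Delta> * (c + 1) ^ k" if "i < n" for i
  proof -
    have "\<bar>comb \<omega> i\<bar> \<le> mag \<omega> i" using mag_nonneg[of \<omega> i] \<omega>
      by (simp add: comb[OF that] abs_mult abs_sgn_eq)
    also have "\<dots> \<le> \<Delta> * N" using mag_\<omega>[OF that] .
    finally show ?thesis using \<open>\<Delta> * N \<le> \<Delta> * (real n * (c + 1) ^ k)\<close>
      by (simp add: mult.assoc mult.left_commute)
  qed
  have estimate: "2 * ((comb \<alpha> i + comb \<beta> i) * comb \<omega> i) \<le> \<epsilon> * (comb \<alpha> i * comb \<beta> i)"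
    if i: "i < k" for i
  proof -
    have "i < n" using i k by simp
    consider "i \<in> I" | "i \<notin> I" "d i = 0" | "i \<notin> I" "d i \<noteq> 0" by blast
    then show ?thesis
    proof cases
      case 1
      \<comment> \<open>Either \<open>u j\<close> does not move the near coordinate
        \<open>i\<close>, or its coefficient \<open>\<mu> j\<close> was set to 0.\<close>
      then have "\<alpha> j * u j i = 0" "\<beta> j * u j i = 0" for j
        by (auto simp: near_def \<alpha>_def \<beta>_def \<mu>_def)
      then have "comb \<alpha> i = 0" "comb \<beta> i = 0" unfolding comb_def by (auto intro!: sum.neutral)
      then show ?thesis by simp
    next
      case 2
      then show ?thesis by (simp add: comb[OF \<open>i < n\<close>])
    next
      case 3
      have "mag \<omega> i \<le> \<epsilon> * \<bar>d i\<bar> / 10 \<and> mag \<beta> i - mag \<alpha> i \<le> \<bar>d i\<bar> / 10 \<and> 0 \<le> mag \<beta> i - mag \<alpha> i"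
      proof (intro conjI)
        have *: "\<Delta> * N \<le> \<epsilon> * \<bar>d i\<bar> / 10"
          using far[OF i 3(1)] eps by (simp add: N_def c_def field_simps)
        then show "mag \<omega> i \<le> \<epsilon> * \<bar>d i\<bar> / 10" using mag_\<omega>[OF \<open>i < n\<close>] by simp
        have eq: "mag \<beta> i - mag \<alpha> i = (\<Sum>j\<in>J. (\<beta> j - \<alpha> j) * \<bar>u j i\<bar>)"
          by (simp add: mag_def sum_subtractf left_diff_distrib)
        show "0 \<le> mag \<beta> i - mag \<alpha> i" unfolding eq using ab_diff by (intro sum_nonneg) auto
        \<comment> \<open>The halves differ by at most \<open>\<Delta>\<close> per term;
          \<open>real n <= N\<close> lets the gap of the far coordinates absorb this as
          well.\<close>
        have "mag \<beta> i - mag \<alpha> i \<le> (\<Sum>j\<in>J. 1 * \<Delta>)"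
          unfolding eq using ab_diff u \<open>i < n\<close> \<Delta> by (intro sum_mono mult_mono) auto
        also have "\<dots> \<le> \<Delta> * N" using J(2) n_le_N \<Delta> by (simp add: mult.commute mult_mono)
        also have "\<dots> \<le> 1 * \<bar>d i\<bar> / 10"
          using * mult_right_mono[OF eps(2), of "\<bar>d i\<bar>"] by simp
        finally show "mag \<beta> i - mag \<alpha> i \<le> \<bar>d i\<bar> / 10" by simp
      qed
      then have "2 * (mag \<alpha> i + mag \<beta> i) * mag \<omega> i \<le> \<epsilon> * (mag \<alpha> i * mag \<beta> i)"
        using mag_d[OF \<open>i < n\<close>] mag_nonneg[of \<alpha> i] mag_nonneg[of \<beta> i] mag_nonneg[of \<omega> i] \<alpha> \<beta> \<omega>
        by (intro far_coordinate_estimate[OF eps]) auto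
      \<comment> \<open>Both sides are products of two coordinates with a common sign, which squares
        away.\<close>
      moreover have "sgn (d i) * sgn (d i) = 1" using 3 by (simp add: sgn_if)
      moreover have "2 * ((s * x + s * y) * (s * z)) = (s * s) * (2 * (x + y) * z)"
        "\<epsilon> * ((s * x) * (s * y)) = (s * s) * (\<epsilon> * (x * y))" for s x y z :: real
        by (simp_all add: algebra_simps)
      ultimately show ?thesis unfolding comb[OF \<open>i < n\<close>] by (simp only: mult_1)
    qed
  qed
  have row_bounds: "min 0 (row_val n (\<lambda>i. A $$ (r, i)) d) \<le> row_val n (\<lambda>i. A $$ (r, i)) (comb \<kappa>) \<and>
      row_val n (\<lambda>i. A $$ (r, i)) (comb \<kappa>) \<le> max 0 (row_val n (\<lambda>i. A $$ (r, i)) d)"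
    if "r < m" "\<And>j. j \<in> J \<Longrightarrow> 0 \<le> \<kappa> j \<and> \<kappa> j \<le> t j" for r \<kappa>
  proof -
    let ?R = "row_val n (\<lambda>i. A $$ (r, i))"
    have "?R d = ?R (comb t)" unfolding row_val_def comb_def using d by (intro sum.cong) auto
    then have "(\<Sum>j\<in>J. t j * ?R (u j)) = ?R d" by (simp add: comb_def row_val_sum)
    from conformal_partial_sum_bounds[OF this, of \<kappa>] that rows show ?thesis
      by (simp add: comb_def row_val_sum)
  qed
  have comb_add: "(\<lambda>i. comb \<alpha> i + comb \<beta> i) = comb (\<lambda>j. \<alpha> j + \<beta> j)"
    by (simp add: comb_def fun_eq_iff sum.distrib distrib_right)
  have \<kappa>: "0 \<le> \<alpha> j \<and> \<alpha> j \<le> t j" "0 \<le> \<beta> j \<and> \<beta> j \<le> t j" "0 \<le> \<alpha> j + \<beta> j \<and> \<alpha> j + \<beta> j \<le> t j"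
    if "j \<in> J" for j using \<alpha>[OF that] \<beta>[OF that] \<alpha>\<beta>[of j] \<mu>[OF that] by linarith+
  have row_props: "\<forall>r<m. \<forall>s\<in>{comb \<alpha>, comb \<beta>, \<lambda>i. comb \<alpha> i + comb \<beta> i}. let R = row_val n (\<lambda>i. A $$ (r, i)) in
      min 0 (R d) \<le> R s \<and> R s \<le> max 0 (R d)"
  proof (intro allI impI ballI)
    fix r s assume r: "r < m" and "s \<in> {comb \<alpha>, comb \<beta>, \<lambda>i. comb \<alpha> i + comb \<beta> i}"
    then obtain \<kappa> where s: "s = comb \<kappa>" and "\<kappa> \<in> {\<alpha>, \<beta>, \<lambda>j. \<alpha> j + \<beta> j}"
      unfolding comb_add by auto
    then have "0 \<le> \<kappa> j \<and> \<kappa> j \<le> t j" if "j \<in> J" for j using \<kappa>[OF that] by auto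
    from row_bounds[OF r this] s
    show "let R = row_val n (\<lambda>i. A $$ (r, i)) in min 0 (R d) \<le> R s \<and> R s \<le> max 0 (R d)"
      by (simp only: Let_def)
  qed
  have ints: "comb \<alpha> i \<in> \<int>" "comb \<beta> i \<in> \<int>" if "i < n" for i
    unfolding comb_def \<alpha>_def \<beta>_def using u that by (auto intro!: Ints_sum Ints_mult)
  show ?thesis
    by (rule exI[of _ "comb \<alpha>"], rule exI[of _ "comb \<beta>"], rule exI[of _ "comb \<omega>"],
        insert ints d_split dist[unfolded \<Delta>_def c_def] estimate, intro conjI row_props allI impI)
      (simp_all only:)
qed

section \<open>Proximity\<close>

text \<open>The mixed second difference of a quadratic does not depend on the base point: the linear
  part cancels and only the cross terms of \<open>p\<close> and \<open>r\<close> survive.\<close>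

lemma concave_objective_add_add:
  assumes "x \<in> carrier_vec n" "p \<in> carrier_vec n" "r \<in> carrier_vec n" "h \<in> carrier_vec n" "k \<le> n"
  shows "concave_objective k q h (x + p) + concave_objective k q h (x + r) =
    concave_objective k q h x + concave_objective k q h (x + (p + r)) + 2 * (\<Sum>i<k. q i * (p $ i * r $ i))"
proof -
  have "(\<Sum>i<k. - q i * ((x + p) $ i)\<^sup>2) + (\<Sum>i<k. - q i * ((x + r) $ i)\<^sup>2) =
    (\<Sum>i<k. - q i * (x $ i)\<^sup>2) + (\<Sum>i<k. - q i * ((x + (p + r)) $ i)\<^sup>2) +
    2 * (\<Sum>i<k. q i * (p $ i * r $ i))"
    unfolding sum_distrib_left sum.distrib[symmetric] using assms
    by (intro sum.cong) (auto simp: power2_eq_square algebra_simps)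
  then show ?thesis using assms
    by (simp add: concave_objective_def scalar_prod_add_distrib[where n = n])
qed

lemma mem_polyhedron_iff:
  assumes "A \<in> carrier_mat m n" "b \<in> carrier_vec m"
  shows "x \<in> polyhedron A b \<longleftrightarrow>
    x \<in> carrier_vec n \<and> (\<forall>r<m. row_val n (\<lambda>i. A $$ (r, i)) (\<lambda>i. x $ i) \<le> b $ r)"
  using assms
  by (auto simp: polyhedron_def less_eq_vec_def row_val_def scalar_prod_def lessThan_atLeast0)

text \<open>The supremum is bounded below by the average of \<open>f y\<close> and
  \<open>f z\<close>, so it is immaterial which of the two is larger.\<close>

lemma approximate_solutionI:
  assumes "optimal_solution f S x_opt" "x \<in> S" "y \<in> S" "z \<in> S" "0 < \<epsilon>"
    and "2 * (f x - f x_opt) \<le> \<epsilon> * (f y + f z - 2 * f x_opt)"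
  shows "approximate_solution f S \<epsilon> x"
proof -
  have "f x - f x_opt \<le> \<epsilon> * (Sup (f ` S) - f x_opt)" if "bdd_above (f ` S)"
  proof -
    have "f y \<le> Sup (f ` S)" "f z \<le> Sup (f ` S)" using assms that by (auto intro: cSUP_upper)
    then have "f y + f z - 2 * f x_opt \<le> 2 * (Sup (f ` S) - f x_opt)" by simp
    then have "\<epsilon> * (f y + f z - 2 * f x_opt) \<le> \<epsilon> * (2 * (Sup (f ` S) - f x_opt))"
      using assms(5) by (intro mult_left_mono) auto
    also have "\<dots> = 2 * (\<epsilon> * (Sup (f ` S) - f x_opt))" by simp
    finally have "2 * (f x - f x_opt) \<le> 2 * (\<epsilon> * (Sup (f ` S) - f x_opt))"
      by (rule order_trans[OF assms(6)])
    then show ?thesis by (rule mult_left_le_imp_le) simp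
  qed
  then show ?thesis using assms unfolding approximate_solution_def by auto
qed

lemma linf_norm_le:
  assumes "0 \<le> c" "\<And>i. i < dim_vec x \<Longrightarrow> \<bar>x $ i\<bar> \<le> c"
  shows "linf_norm x \<le> c"
  unfolding linf_norm_def using assms by (subst Max_le_iff) auto

text \<open>Row values of \<open>x + s\<close> and \<open>y - s\<close> lie between those of
  \<open>x\<close> and \<open>y\<close>, whence feasibility. The norm is taken of \<open>- w\<close>
  because both distances in the theorem are norms of this vector.\<close>

lemma ex_proximity_vectors:
  fixes A :: "int mat" and \<epsilon> :: real
  assumes A: "A \<in> carrier_mat m n" and b: "b \<in> carrier_vec m" and "k \<le> n" and "0 < \<epsilon>" "\<epsilon> \<le> 1"
    and q: "\<forall>i<k. q i > 0"
    and x: "x \<in> polyhedron A b" and y: "y \<in> polyhedron A b"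
  shows "\<exists>v v' w. v \<in> integer_points n \<and> v' \<in> integer_points n \<and> w \<in> carrier_vec n \<and>
    y = x + (v + v' + w) \<and>
    linf_norm (- w) \<le> real n * real_of_int (max_subdet A) * (10 * real_of_int (max_subdet A) / \<epsilon> + 1) ^ k \<and>
    2 * (\<Sum>i<k. q i * ((v + v') $ i * w $ i)) \<le> \<epsilon> * (\<Sum>i<k. q i * (v $ i * v' $ i)) \<and>
    (\<forall>s\<in>{v, v', v + v'}. x + s \<in> polyhedron A b \<and> y - s \<in> polyhedron A b)"
proof -
  let ?B = "real n * real_of_int (max_subdet A) * (10 * real_of_int (max_subdet A) / \<epsilon> + 1) ^ k"
  let ?d = "\<lambda>i. y $ i - x $ i"
  obtain a a' e where e: "\<forall>i<n. a i \<in> \<int> \<and> a' i \<in> \<int> \<and> ?d i = a i + a' i + e i \<and> \<bar>e i\<bar> \<le> ?B"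
    and est: "\<forall>i<k. 2 * ((a i + a' i) * e i) \<le> \<epsilon> * (a i * a' i)"
    and rows: "\<forall>r<m. \<forall>s\<in>{a, a', \<lambda>i. a i + a' i}. let R = row_val n (\<lambda>i. A $$ (r, i)) in
      min 0 (R ?d) \<le> R s \<and> R s \<le> max 0 (R ?d)"
    using ex_proximity_splitting[OF A assms(3,4,5), of ?d] by (elim exE conjE)
  have xn: "x \<in> carrier_vec n" and yn: "y \<in> carrier_vec n"
    using x y mem_polyhedron_iff[OF A b] by auto
  have mem: "x + vec n s \<in> polyhedron A b \<and> y - vec n s \<in> polyhedron A b"
    if s: "s \<in> {a, a', \<lambda>i. a i + a' i}" for s
  proof -
    have "row_val n (\<lambda>i. A $$ (r, i)) (\<lambda>i. (x + vec n s) $ i) \<le> b $ r \<and>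
      row_val n (\<lambda>i. A $$ (r, i)) (\<lambda>i. (y - vec n s) $ i) \<le> b $ r" if r: "r < m" for r
    proof -
      let ?R = "row_val n (\<lambda>i. A $$ (r, i))"
      have "?R (\<lambda>i. (x + vec n s) $ i) = ?R (\<lambda>i. x $ i) + ?R s"
        "?R (\<lambda>i. (y - vec n s) $ i) = ?R (\<lambda>i. y $ i) - ?R s"
        "?R ?d = ?R (\<lambda>i. y $ i) - ?R (\<lambda>i. x $ i)"
        by (simp_all add: row_val_def algebra_simps sum.distrib sum_subtractf)
      moreover have "?R (\<lambda>i. x $ i) \<le> b $ r" "?R (\<lambda>i. y $ i) \<le> b $ r"
        using x y r mem_polyhedron_iff[OF A b] by auto
      moreover have "min 0 (?R ?d) \<le> ?R s" "?R s \<le> max 0 (?R ?d)"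
        using rows r s unfolding Let_def by blast+
      ultimately show ?thesis by linarith
    qed
    then show ?thesis using xn yn by (auto simp: mem_polyhedron_iff[OF A b])
  qed
  let ?v = "vec n a" and ?v' = "vec n a'" and ?w = "vec n e"
  have add: "?v + ?v' = vec n (\<lambda>i. a i + a' i)" by auto
  have "2 * (q i * ((?v + ?v') $ i * ?w $ i)) \<le> \<epsilon> * (q i * (?v $ i * ?v' $ i))" if "i < k" for i
  proof -
    have "q i * (2 * ((a i + a' i) * e i)) \<le> q i * (\<epsilon> * (a i * a' i))"
      using est q that by (intro mult_left_mono) auto
    then show ?thesis using that assms(3) by (simp add: mult.left_commute)
  qed
  then have sum_le: "2 * (\<Sum>i<k. q i * ((?v + ?v') $ i * ?w $ i)) \<le> \<epsilon> * (\<Sum>i<k. q i * (?v $ i * ?v' $ i))"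
    unfolding sum_distrib_left by (intro sum_mono) auto
  have "0 \<le> ?B" using max_subdet_ge_1[of A] assms(4) by simp
  then have norm: "linf_norm (- ?w) \<le> ?B" using e by (intro linf_norm_le) auto
  have "y $ i = x $ i + (a i + a' i + e i)" if "i < n" for i
    using e that by (metis add.commute diff_add_cancel)
  then have y_eq: "y = x + (?v + ?v' + ?w)" using xn yn by (intro eq_vecI) auto
  show ?thesis
    by (rule exI[of _ ?v], rule exI[of _ ?v'], rule exI[of _ ?w],
        insert y_eq norm sum_le mem e, intro conjI) (auto simp: add integer_points_def)
qed

theorem theorem1:
  fixes n m k :: nat and A :: "int mat" and b h :: "real Matrix.vec" and q :: "nat \<Rightarrow> real"
  assumes "n \<ge> 1" and "k \<le> n"
    and "A \<in> carrier_mat m n" and "b \<in> carrier_vec m" and "h \<in> carrier_vec n"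
    and "\<forall>i<k. q i > 0"
    and "\<exists>x. optimal_solution (concave_objective k q h) (polyhedron A b \<inter> integer_points n) x"
    and "\<exists>x. optimal_solution (concave_objective k q h) (polyhedron A b) x"
  shows "(\<forall>xc. optimal_solution (concave_objective k q h) (polyhedron A b) xc \<longrightarrow>
           (\<forall>\<epsilon>::real. 0 < \<epsilon> \<and> \<epsilon> \<le> 1 \<longrightarrow>
             (\<exists>xs. approximate_solution (concave_objective k q h)
                     (polyhedron A b \<inter> integer_points n) \<epsilon> xs \<and>
                   linf_norm (xc - xs) \<le> real n * real_of_int (max_subdet A) *
                     (10 * real_of_int (max_subdet A) / \<epsilon> + 1) ^ k)))
       \<and> (\<forall>xd. optimal_solution (concave_objective k q h)
                  (polyhedron A b \<inter> integer_points n) xd \<longrightarrow>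
           (\<forall>\<epsilon>::real. 0 < \<epsilon> \<and> \<epsilon> \<le> 1 \<longrightarrow>
             (\<exists>xs. approximate_solution (concave_objective k q h) (polyhedron A b) \<epsilon> xs \<and>
                   linf_norm (xs - xd) \<le> real n * real_of_int (max_subdet A) *
                     (10 * real_of_int (max_subdet A) / \<epsilon> + 1) ^ k)))"
proof -
  let ?f = "concave_objective k q h" and ?P = "polyhedron A b" and ?Z = "integer_points n"
  let ?B = "\<lambda>\<epsilon>. real n * real_of_int (max_subdet A) * (10 * real_of_int (max_subdet A) / \<epsilon> + 1) ^ k"
  \<comment> \<open>The same \<open>v\<close> and \<open>v'\<close> serve both claims; each claim
    also uses an optimal solution of the other problem.\<close>
  have both: "(\<exists>xs. approximate_solution ?f (?P \<inter> ?Z) \<epsilon> xs \<and> linf_norm (xc - xs) \<le> ?B \<epsilon>) \<and>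
      (\<exists>xs. approximate_solution ?f ?P \<epsilon> xs \<and> linf_norm (xs - xd) \<le> ?B \<epsilon>)"
    if xc: "optimal_solution ?f ?P xc" and xd: "optimal_solution ?f (?P \<inter> ?Z) xd"
      and eps: "0 < \<epsilon>" "\<epsilon> \<le> 1" for xc xd \<epsilon>
  proof -
    have xcP: "xc \<in> ?P" and xdP: "xd \<in> ?P" and xdZ: "xd \<in> ?Z"
      using xc xd by (auto simp: optimal_solution_def)
    obtain v v' w where vZ: "v \<in> ?Z" "v' \<in> ?Z" and w: "w \<in> carrier_vec n"
      and xd_eq: "xd = xc + (v + v' + w)" and norm: "linf_norm (- w) \<le> ?B \<epsilon>"
      and est: "2 * (\<Sum>i<k. q i * ((v + v') $ i * w $ i)) \<le> \<epsilon> * (\<Sum>i<k. q i * (v $ i * v' $ i))"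
      and mem: "\<forall>s\<in>{v, v', v + v'}. xc + s \<in> ?P \<and> xd - s \<in> ?P"
      using ex_proximity_vectors[OF assms(3,4,2) eps assms(6) xcP xdP] by (elim exE conjE)
    let ?Q = "\<Sum>i<k. q i * (v $ i * v' $ i)"
    have v: "v \<in> carrier_vec n" "v' \<in> carrier_vec n" using vZ by (auto simp: integer_points_def)
    have xcn: "xc \<in> carrier_vec n" and xdn: "xd \<in> carrier_vec n"
      using xcP xdP mem_polyhedron_iff[OF assms(3,4)] by auto
    have Z: "xd - v \<in> ?Z" "xd - v' \<in> ?Z" "xd - (v + v') \<in> ?Z"
      using xdZ vZ by (auto simp: integer_points_def)
    have eqs: "xc + w = xd - (v + v')" "xd + - v = xd - v" "xd + - v' = xd - v'"
      "xd + (- v + - v') = xd - (v + v')" "xc - (xd - (v + v')) = - w" "xc + (v + v') - xd = - w"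
      using xcn xdn v w unfolding xd_eq by (auto intro!: eq_vecI)
    \<comment> \<open>As \<open>xd - (v + v')\<close> is \<open>xc + w\<close>, this is the second
      difference at \<open>xc\<close> in the directions \<open>v + v'\<close> and
      \<open>w\<close>.\<close>
    have "?f (xc + (v + v')) + ?f (xd - (v + v')) =
        ?f xc + ?f xd + 2 * (\<Sum>i<k. q i * ((v + v') $ i * w $ i))"
      using concave_objective_add_add[of xc n "v + v'" w h k q] xcn v w assms(2,5)
      unfolding eqs(1) xd_eq[symmetric] by simp
    then have "?f (xc + (v + v')) + ?f (xd - (v + v')) \<le> ?f xc + ?f xd + \<epsilon> * ?Q"
      using est by linarith
    moreover have "?f (xc + v) + ?f (xc + v') = ?f xc + ?f (xc + (v + v')) + 2 * ?Q"
      using concave_objective_add_add[of xc n v v' h k q] xcn v assms(2,5) by simp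
    moreover have "?f (xd - v) + ?f (xd - v') = ?f xd + ?f (xd - (v + v')) + 2 * ?Q"
    proof -
      have "(\<Sum>i<k. q i * ((- v) $ i * (- v') $ i)) = ?Q"
        using v assms(2) by (intro sum.cong) auto
      then show ?thesis
        using concave_objective_add_add[of xd n "- v" "- v'" h k q] xdn v assms(2,5)
        by (simp add: eqs)
    qed
    moreover have c_le: "?f xc \<le> ?f (xc + (v + v'))"
      using xc mem by (auto simp: optimal_solution_def)
    moreover have d_le: "?f xd \<le> ?f (xd - (v + v'))"
      using xd mem Z by (auto simp: optimal_solution_def)
    \<comment> \<open>Optimality of \<open>xd\<close> bounds the loss at
      \<open>xc + (v + v')\<close>, and optimality of \<open>xc\<close> the loss at
      \<open>xd - (v + v')\<close>. The lower bounds for the half steps use the optimality of their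
      own starting point.\<close>
    ultimately have
      c: "?f (xc + (v + v')) - ?f xc \<le> \<epsilon> * ?Q" "2 * ?Q \<le> ?f (xc + v) + ?f (xc + v') - 2 * ?f xc" and
      d: "?f (xd - (v + v')) - ?f xd \<le> \<epsilon> * ?Q" "2 * ?Q \<le> ?f (xd - v) + ?f (xd - v') - 2 * ?f xd"
      by linarith+
    have scale: "2 * t \<le> \<epsilon> * g" if "t \<le> \<epsilon> * ?Q" "2 * ?Q \<le> g" for t g
    proof -
      have "2 * (\<epsilon> * ?Q) = \<epsilon> * (2 * ?Q)" by simp
      also have "\<dots> \<le> \<epsilon> * g" using that(2) eps(1) by (intro mult_left_mono) auto
      finally show ?thesis using that(1) by linarith
    qed
    have "2 * (?f (xc + (v + v')) - ?f xc) \<le> \<epsilon> * (?f (xc + v) + ?f (xc + v') - 2 * ?f xc)"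
      by (rule scale[OF c])
    then have "approximate_solution ?f ?P \<epsilon> (xc + (v + v'))"
      using approximate_solutionI[OF xc] mem eps(1) by blast
    moreover have "2 * (?f (xd - (v + v')) - ?f xd) \<le> \<epsilon> * (?f (xd - v) + ?f (xd - v') - 2 * ?f xd)"
      by (rule scale[OF d])
    then have "approximate_solution ?f (?P \<inter> ?Z) \<epsilon> (xd - (v + v'))"
      using approximate_solutionI[OF xd] mem Z eps(1) by blast
    ultimately show ?thesis using norm eqs(5,6) by metis
  qed
  then show ?thesis using assms(7,8) by blast
qed

end
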